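(* Suppose that $\alpha_{\min}<\alpha_{\max}$. Then: (i) $P_\varphi'$ is strictly increasing on $\mathbb{R}$. (ii) $\alpha_{\min}\le P'_\varphi(-\infty)<P'_\varphi(+\infty)\le\alpha_{\max}$.
   Context: Let $m\ge2$, $\ell\ge2$, $q\ge2$ be integers, $S=\{0,1,\dots,m-1\}$, and $\varphi:S^\ell\to\mathbb{R}$ a function; $\alpha_{\min}=\min_{S^\ell}\varphi$, $\alpha_{\max}=\max_{S^\ell}\varphi$. For $s\in\mathbb{R}$, $\psi_s:S^{\ell-1}\to(0,\infty)$ is the unique strictly positive function satisfying $$\psi_s(a_1,\dots,a_{\ell-1})^q=\sum_{j\in S}e^{s\varphi(a_1,\dots,a_{\ell-1},j)}\,\psi_s(a_2,\dots,a_{\ell-1},j)\qquad\text{for all }(a_1,\dots,a_{\ell-1})\in S^{\ell-1}.$$ It is extended to $S^k$ for $1\le k\le\ell-2$, downwards in $k$, by $\psi_s(a)=\big(\sum_{j\in S}\psi_s(a,j)\big)^{1/q}$ for $a\in S^k$. The pressure function is $P_\varphi(s)=(q-1)q^{\ell-2}\log\sum_{j\in S}\psi_s(j)$, which is analytic and convex on $\mathbb{R}$, and $P'_\varphi(\pm\infty)=\lim_{s\to\pm\infty}P'_\varphi(s)$. *)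

theory Defs
  imports "HOL-Analysis.Analysis"
begin

text \<open>
  The alphabet is \<open>S = {..<m}\<close>; a tuple \<open>(a\<^sub>1, \<dots>, a\<^sub>k) \<in> S\<^sup>k\<close> is the list \<open>[a\<^sub>1, \<dots>, a\<^sub>k]\<close>, so
  \<open>(a\<^sub>2, \<dots>, a\<^sub>k, j)\<close> is \<open>tl a @ [j]\<close>. The function \<open>\<phi>\<close> matters only on \<open>words m l\<close>.
\<close>

definition words :: "nat \<Rightarrow> nat \<Rightarrow> nat list set" where
  "words m k = {a. length a = k \<and> set a \<subseteq> {..<m}}"

definition alpha_min :: "nat \<Rightarrow> nat \<Rightarrow> (nat list \<Rightarrow> real) \<Rightarrow> real" where
  "alpha_min m l \<phi> = Min (\<phi> ` words m l)"

definition alpha_max :: "nat \<Rightarrow> nat \<Rightarrow> (nat list \<Rightarrow> real) \<Rightarrow> real" where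
  "alpha_max m l \<phi> = Max (\<phi> ` words m l)"

text \<open>
  \<open>extensional\<close> fixes the values off \<open>S\<^sup>l\<^sup>-\<^sup>1\<close>, so that uniqueness of a function on \<open>S\<^sup>l\<^sup>-\<^sup>1\<close>
  becomes uniqueness of a HOL function, as \<open>THE\<close> requires.
\<close>

definition psi_top :: "nat \<Rightarrow> nat \<Rightarrow> nat \<Rightarrow> (nat list \<Rightarrow> real) \<Rightarrow> real \<Rightarrow> nat list \<Rightarrow> real" where
  "psi_top m l q \<phi> s = (THE f. f \<in> extensional (words m (l - 1)) \<and>
     (\<forall>a \<in> words m (l - 1). f a > 0 \<and>
        f a ^ q = (\<Sum>j<m. exp (s * \<phi> (a @ [j])) * f (tl a @ [j]))))"

text \<open>Meaningful on words of length \<open>1, \<dots>, l - 1\<close>.\<close>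

function psi :: "nat \<Rightarrow> nat \<Rightarrow> nat \<Rightarrow> (nat list \<Rightarrow> real) \<Rightarrow> real \<Rightarrow> nat list \<Rightarrow> real" where
  "psi m l q \<phi> s a =
     (if length a \<ge> l - 1 then psi_top m l q \<phi> s a
      else (\<Sum>j<m. psi m l q \<phi> s (a @ [j])) powr (1 / real q))"
  by auto
termination
  by (relation "Wellfounded.measure (\<lambda>(m, l, q, \<phi>, s, a). l - 1 - length a)") auto

declare psi.simps [simp del]

definition pressure :: "nat \<Rightarrow> nat \<Rightarrow> nat \<Rightarrow> (nat list \<Rightarrow> real) \<Rightarrow> real \<Rightarrow> real" where
  "pressure m l q \<phi> s = (real q - 1) * real q ^ (l - 2) * ln (\<Sum>j<m. psi m l q \<phi> s [j])"

end

theory Submission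
  imports Defs
begin

text \<open>
  Put \<open>F\<^sub>s = ln \<circ> \<psi>\<^sub>s\<close> and let it live on all words of length at most \<open>l - 1\<close>, the empty one
  included. The equation for \<open>\<psi>\<^sub>s\<close> on the longest words and its extension to shorter ones then
  become one recursion,
  \<open>q F\<^sub>s(a) = ln (\<Sum>\<^sub>j exp (s w(a, j) + F\<^sub>s(a \<cdot> j)))\<close>, where \<open>w(a, j)\<close> is \<open>\<phi>(a, j)\<close> on the longest
  words and \<open>0\<close> elsewhere, and \<open>a \<cdot> j\<close> appends \<open>j\<close>, dropping the first letter of a longest word.
  The pressure is \<open>(q - 1) q\<^sup>l\<^sup>-\<^sup>1 F\<^sub>s([])\<close>.

  Since \<open>q > 1\<close>, a maximum principle controls such recursions: if for each \<open>a\<close> there is a \<open>b\<close> with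
  \<open>q d(a) \<le> d(b) + c\<close>, then \<open>d \<le> c / (q - 1)\<close>, as one sees at a maximum of \<open>d\<close>. Everything is
  obtained by applying it to a suitable \<open>d\<close>:

  \<^item> Differences of two solutions give uniqueness of \<open>\<psi>\<^sub>s\<close>; the same contraction gives existence.

  \<^item> Formal differentiation in \<open>s\<close> gives the linear recursion
    \<open>q G\<^sub>s(a) = \<Sum>\<^sub>j p\<^sub>s(a, j) (w(a, j) + G\<^sub>s(a \<cdot> j))\<close> with probability weights \<open>p\<^sub>s(a, \<cdot>)\<close>; it has a
    solution for the same reason. Let \<open>e = F\<^sub>t - F\<^sub>s - (t - s) G\<^sub>s\<close>. The tangent inequality for
    log-sum-exp gives \<open>e \<ge> 0\<close>, and differentiability of log-sum-exp gives \<open>e = o(t - s)\<close>. So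
    \<open>G\<^sub>s\<close> is the derivative of \<open>F\<^sub>s\<close>.

  \<^item> If \<open>e\<close> vanishes at the empty word for some \<open>s \<noteq> t\<close>, equality holds in all tangent inequalities
    along the tree of words. This forces \<open>F\<^sub>t - F\<^sub>s\<close> to depend on the length of the word only, and
    then \<open>\<phi>\<close> to be constant. Hence the graph of the pressure lies strictly above each of its
    tangents elsewhere, and adding the tangent inequalities at \<open>s\<close> and \<open>t\<close> shows that the
    derivative is strictly increasing.

  \<^item> Replacing \<open>\<phi>\<close> by a constant \<open>\<alpha>\<close>, the linear recursion has the explicit solution
    \<open>\<alpha> q\<^sup>|\<^sup>a\<^sup>| / ((q - 1) q\<^sup>l\<^sup>-\<^sup>1)\<close>. Comparing \<open>G\<^sub>s\<close> with it for \<open>\<alpha> = \<alpha>\<^sub>m\<^sub>i\<^sub>n\<close> and \<open>\<alpha> = \<alpha>\<^sub>m\<^sub>a\<^sub>x\<close> bounds the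
    derivative of the pressure.
\<close>

section \<open>Maximum principle and fixed points\<close>

lemma maximum_principle:
  fixes d :: "'a \<Rightarrow> real"
  assumes "finite W" "q > 1" and step: "\<And>a. a \<in> W \<Longrightarrow> \<exists>b\<in>W. q * d a \<le> d b + c"
    and "a \<in> W"
  shows "d a \<le> c / (q - 1)"
proof -
  have ne: "d ` W \<noteq> {}" "finite (d ` W)" using assms by auto
  obtain a' where a': "a' \<in> W" "d a' = Max (d ` W)" using Max_in[OF ne(2,1)] by force
  obtain b where b: "b \<in> W" "q * d a' \<le> d b + c" using step a' by blast
  have "d b \<le> d a'" using a' b ne by simp
  hence "d a' * (q - 1) \<le> c" using b by (simp add: algebra_simps)
  hence "d a' \<le> c / (q - 1)" using assms(2) by (simp add: pos_le_divide_eq)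
  moreover have "d a \<le> d a'" using a' ne assms(4) by simp
  ultimately show ?thesis by simp
qed

text \<open>
  The hypothesis, applied to \<open>(f, g)\<close> and to \<open>(g, f)\<close>, makes \<open>T\<close> a \<open>1/q\<close>-contraction for the
  maximum norm on \<open>W\<close>, so the iterates from \<open>0\<close> converge geometrically. The one-sided form is what
  log-sum-exp and weighted means provide directly, and it is the form used by the maximum principle.
\<close>
lemma contraction_fixed_point:
  fixes T :: "('a \<Rightarrow> real) \<Rightarrow> 'a \<Rightarrow> real"
  assumes fin: "finite W" and q: "q > 1"
    and contr: "\<And>f g a. a \<in> W \<Longrightarrow> \<exists>b\<in>W. q * (T f a - T g a) \<le> f b - g b"
  shows "\<exists>f. \<forall>a\<in>W. f a = T f a"
proof -
  define x where "x n = (T ^^ n) (\<lambda>_. 0)" for n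
  have xS: "x (Suc n) = T (x n)" for n by (simp add: x_def)
  define M where "M = (\<Sum>a\<in>W. \<bar>x 1 a - x 0 a\<bar>)"
  have step: "\<bar>T f a - T g a\<bar> \<le> D / q" if a: "a \<in> W" and D: "\<And>b. b \<in> W \<Longrightarrow> \<bar>f b - g b\<bar> \<le> D" for f g a D
  proof -
    obtain b b' where "b \<in> W" "q * (T f a - T g a) \<le> f b - g b"
      and "b' \<in> W" "q * (T g a - T f a) \<le> g b' - f b'"
      using contr[OF a] by meson
    with D[of b] D[of b'] have "q * (T f a - T g a) \<le> D" "q * (T g a - T f a) \<le> D"
      by linarith+
    thus ?thesis using q by (simp add: pos_le_divide_eq abs_le_iff mult.commute)
  qed
  have close: "\<bar>x (Suc n) a - x n a\<bar> \<le> M * (1 / q) ^ n" if "a \<in> W" for n a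
    using that
  proof (induction n arbitrary: a)
    case 0
    show ?case unfolding M_def using member_le_sum[of a W "\<lambda>a. \<bar>x 1 a - x 0 a\<bar>"] 0 fin by simp
  next
    case (Suc n)
    show ?case using step[OF Suc.prems, of "x (Suc n)" "x n"] Suc.IH by (simp add: xS)
  qed
  have "summable (\<lambda>n. x (Suc n) a - x n a)" if "a \<in> W" for a
  proof (rule summable_comparison_test')
    show "summable (\<lambda>n. M * (1 / q) ^ n)" using q by (intro summable_mult summable_geometric) auto
  qed (use close[OF that] in auto)
  hence "convergent (\<lambda>n. \<Sum>i<n. x (Suc i) a - x i a)" if "a \<in> W" for a
    using that by (simp add: summable_iff_convergent)
  hence "convergent (\<lambda>n. (\<Sum>i<n. x (Suc i) a - x i a) + x 0 a)" if "a \<in> W" for a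
    using that by (intro convergent_add convergent_const)
  moreover have "(\<Sum>i<n. x (Suc i) a - x i a) + x 0 a = x n a" for n a
    using sum_lessThan_telescope[of "\<lambda>n. x n a" n] by simp
  ultimately have "\<exists>L. (\<lambda>n. x n a) \<longlonglongrightarrow> L" if "a \<in> W" for a
    using that by (simp add: convergent_def)
  then obtain f where f: "\<And>a. a \<in> W \<Longrightarrow> (\<lambda>n. x n a) \<longlonglongrightarrow> f a" by metis
  have "f a = T f a" if a: "a \<in> W" for a
  proof -
    have "(\<lambda>n. \<Sum>b\<in>W. \<bar>x n b - f b\<bar>) \<longlonglongrightarrow> (\<Sum>b\<in>W. \<bar>f b - f b\<bar>)"
      by (intro tendsto_intros f)
    hence "(\<lambda>n. (\<Sum>b\<in>W. \<bar>x n b - f b\<bar>) / q) \<longlonglongrightarrow> 0" by (auto intro: tendsto_divide_zero)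
    moreover have "\<bar>x (Suc n) a - T f a\<bar> \<le> (\<Sum>b\<in>W. \<bar>x n b - f b\<bar>) / q" for n
      unfolding xS
      by (rule step[OF a]) (use member_le_sum[of _ W "\<lambda>b. \<bar>x n b - f b\<bar>"] fin in auto)
    ultimately have "(\<lambda>n. x (Suc n) a - T f a) \<longlonglongrightarrow> 0"
      by (intro Lim_null_comparison[of "\<lambda>n. x (Suc n) a - T f a"]) auto
    hence "(\<lambda>n. x (Suc n) a) \<longlonglongrightarrow> T f a" by (simp add: LIM_zero_iff)
    moreover have "(\<lambda>n. x (Suc n) a) \<longlonglongrightarrow> f a" using f[OF a] by (rule LIMSEQ_Suc)
    ultimately show ?thesis by (rule LIMSEQ_unique[symmetric])
  qed
  thus ?thesis by blast
qed

section \<open>Log-sum-exp\<close>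

definition log_sum_exp :: "'j set \<Rightarrow> ('j \<Rightarrow> real) \<Rightarrow> real" where
  "log_sum_exp J x = ln (\<Sum>j\<in>J. exp (x j))"

definition softmax :: "'j set \<Rightarrow> ('j \<Rightarrow> real) \<Rightarrow> 'j \<Rightarrow> real" where
  "softmax J x j = exp (x j) / (\<Sum>i\<in>J. exp (x i))"

lemma sum_exp_pos: "finite J \<Longrightarrow> J \<noteq> {} \<Longrightarrow> 0 < (\<Sum>j\<in>J. exp (x j :: real))"
  by (simp add: sum_pos)

lemma softmax_pos: "finite J \<Longrightarrow> J \<noteq> {} \<Longrightarrow> 0 < softmax J x j"
  by (simp add: softmax_def sum_exp_pos)

lemma sum_softmax: "finite J \<Longrightarrow> J \<noteq> {} \<Longrightarrow> (\<Sum>j\<in>J. softmax J x j) = 1"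
  using sum_exp_pos[of J x] by (simp add: softmax_def flip: sum_divide_distrib)

lemma softmax_mean_le_some:
  assumes "finite J" "J \<noteq> {}"
  shows "\<exists>j\<in>J. (\<Sum>i\<in>J. softmax J x i * v i) \<le> v j"
proof (rule ccontr)
  define c where "c = (\<Sum>i\<in>J. softmax J x i * v i)"
  assume "\<not> ?thesis"
  hence "\<And>j. j \<in> J \<Longrightarrow> v j < c" by (auto simp: c_def not_le)
  hence "c < (\<Sum>i\<in>J. softmax J x i * c)"
    unfolding c_def using assms by (intro sum_strict_mono mult_strict_left_mono softmax_pos) auto
  thus False using sum_softmax[OF assms] by (simp flip: sum_distrib_right)
qed

lemma exp_eq_add_one_iff: "exp (x::real) = 1 + x \<longleftrightarrow> x = 0"
  using ln_eq_minus_one[of "exp x"] by auto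

text \<open>
  Log-sum-exp has gradient \<open>softmax\<close>, and lies above its tangents by Jensen's inequality: the mean of
  \<open>exp (v - c)\<close> is at least that of \<open>1 + (v - c)\<close>, which is \<open>1\<close> as \<open>c\<close> is the mean of \<open>v\<close>. Equality
  forces \<open>exp (v j - c) = 1 + (v j - c)\<close> for each \<open>j\<close>.
\<close>
lemma log_sum_exp_tangent:
  fixes x v :: "'j \<Rightarrow> real"
  assumes "finite J" "J \<noteq> {}"
  defines "c \<equiv> (\<Sum>j\<in>J. softmax J x j * v j)"
  shows "c \<le> log_sum_exp J (\<lambda>j. x j + v j) - log_sum_exp J x"
    and "log_sum_exp J (\<lambda>j. x j + v j) - log_sum_exp J x = c \<Longrightarrow> j \<in> J \<Longrightarrow> v j = c"
proof -
  note J = assms(1,2)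
  let ?p = "softmax J x"
  let ?Z = "\<Sum>j\<in>J. exp (x j)"
  have Z: "?Z > 0" using J by (rule sum_exp_pos)
  let ?E = "\<Sum>j\<in>J. ?p j * exp (v j - c)"
  have E: "?E = (\<Sum>j\<in>J. exp (x j + v j)) / ?Z / exp c"
    by (simp add: softmax_def exp_add exp_diff flip: sum_divide_distrib)
  have Epos: "?E > 0" unfolding E using Z J by (intro divide_pos_pos sum_exp_pos) auto
  have L: "log_sum_exp J (\<lambda>j. x j + v j) - log_sum_exp J x = c + ln ?E"
    unfolding E log_sum_exp_def using Z sum_exp_pos[OF J, of "\<lambda>j. x j + v j"] by (simp add: ln_div ln_mult)
  have mean: "(\<Sum>j\<in>J. ?p j * (1 + (v j - c))) = 1"
    by (simp add: distrib_left right_diff_distrib sum.distrib sum_subtractf sum_softmax[OF J]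
        flip: c_def sum_distrib_right)
  have nonneg: "0 \<le> ?p j * (exp (v j - c) - (1 + (v j - c)))" for j
    using softmax_pos[OF J, of x j] exp_ge_add_one_self[of "v j - c"] by (intro mult_nonneg_nonneg) linarith+
  have diff: "(\<Sum>j\<in>J. ?p j * (exp (v j - c) - (1 + (v j - c)))) = ?E - 1"
    using mean by (simp add: right_diff_distrib[of _ "exp _"] sum_subtractf)
  have "?E \<ge> 1"
    using sum_nonneg[of J "\<lambda>j. ?p j * (exp (v j - c) - (1 + (v j - c)))"] nonneg diff by simp
  thus "c \<le> log_sum_exp J (\<lambda>j. x j + v j) - log_sum_exp J x" unfolding L by simp
  assume "log_sum_exp J (\<lambda>j. x j + v j) - log_sum_exp J x = c" and j: "j \<in> J"
  hence "?E = 1" unfolding L using Epos by simp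
  hence "(\<Sum>j\<in>J. ?p j * (exp (v j - c) - (1 + (v j - c)))) = 0" using diff by simp
  hence "?p j * (exp (v j - c) - (1 + (v j - c))) = 0"
    using j J(1) nonneg by (subst (asm) sum_nonneg_eq_0_iff) auto
  hence "exp (v j - c) = 1 + (v j - c)" using softmax_pos[OF J, of x j] by simp
  thus "v j = c" by (simp only: exp_eq_add_one_iff)
qed

text \<open>Linearise at \<open>x\<close>: the difference is at most a weighted mean of the values \<open>x j - y j\<close>.\<close>
lemma log_sum_exp_diff_le:
  assumes "finite J" "J \<noteq> {}"
  shows "\<exists>j\<in>J. log_sum_exp J x - log_sum_exp J y \<le> x j - y j"
proof -
  obtain j where "j \<in> J" "(\<Sum>i\<in>J. softmax J x i * (x i - y i)) \<le> x j - y j"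
    using softmax_mean_le_some[OF assms, of x "\<lambda>i. x i - y i"] by blast
  moreover have "(\<Sum>i\<in>J. softmax J x i * (y i - x i)) = - (\<Sum>i\<in>J. softmax J x i * (x i - y i))"
    by (simp add: right_diff_distrib sum_subtractf)
  moreover have "(\<Sum>i\<in>J. softmax J x i * (y i - x i)) \<le> log_sum_exp J y - log_sum_exp J x"
    using log_sum_exp_tangent(1)[OF assms, of x "\<lambda>i. y i - x i"] by simp
  ultimately show ?thesis by force
qed

lemma log_sum_exp_has_derivative:
  assumes "finite J" "J \<noteq> {}"
  shows "((\<lambda>h. log_sum_exp J (\<lambda>j. x j + h * v j)) has_real_derivative
           (\<Sum>j\<in>J. softmax J x j * v j)) (at 0)"
proof -
  have "((\<lambda>h. \<Sum>j\<in>J. exp (x j + h * v j)) has_real_derivative (\<Sum>j\<in>J. exp (x j) * v j)) (at 0)"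
    by (auto intro!: derivative_eq_intros sum.cong)
  from DERIV_chain2[OF DERIV_ln this] show ?thesis
    using sum_exp_pos[OF assms, of x]
    by (simp add: log_sum_exp_def softmax_def sum_distrib_left divide_inverse mult_ac)
qed

section \<open>Log-sum-exp recursions on a finite set\<close>

locale log_sum_exp_system =
  fixes W :: "'a set" and J :: "'j set" and q :: real and nxt :: "'a \<Rightarrow> 'j \<Rightarrow> 'a"
    and w :: "'a \<Rightarrow> 'j \<Rightarrow> real" and F :: "real \<Rightarrow> 'a \<Rightarrow> real"
  assumes finite_W: "finite W" and J: "finite J" "J \<noteq> {}" and q: "q > 1"
    and nxt: "a \<in> W \<Longrightarrow> j \<in> J \<Longrightarrow> nxt a j \<in> W"
    and F: "a \<in> W \<Longrightarrow> q * F s a = log_sum_exp J (\<lambda>j. s * w a j + F s (nxt a j))"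
begin

definition weight :: "real \<Rightarrow> 'a \<Rightarrow> 'j \<Rightarrow> real" where
  "weight s a = softmax J (\<lambda>j. s * w a j + F s (nxt a j))"

lemma weight_pos: "0 < weight s a j"
  and sum_weight: "(\<Sum>j\<in>J. weight s a j) = 1"
  and weighted_mean_le_some: "\<exists>j\<in>J. (\<Sum>i\<in>J. weight s a i * v i) \<le> v j"
  unfolding weight_def using J by (simp_all add: softmax_pos sum_softmax softmax_mean_le_some)

text \<open>The derivative of \<open>F\<close> at \<open>s\<close>, introduced as a solution of the differentiated recursion.\<close>
definition slope :: "real \<Rightarrow> 'a \<Rightarrow> real" where
  "slope s = (SOME G. \<forall>a\<in>W. G a = (\<Sum>j\<in>J. weight s a j * (w a j + G (nxt a j))) / q)"

lemma slope:
  assumes "a \<in> W"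
  shows "q * slope s a = (\<Sum>j\<in>J. weight s a j * (w a j + slope s (nxt a j)))"
proof -
  have "\<exists>G. \<forall>a\<in>W. G a = (\<Sum>j\<in>J. weight s a j * (w a j + G (nxt a j))) / q"
  proof (rule contraction_fixed_point[OF finite_W q])
    fix f g a assume a: "a \<in> W"
    obtain j where "j \<in> J"
      "(\<Sum>i\<in>J. weight s a i * (f (nxt a i) - g (nxt a i))) \<le> f (nxt a j) - g (nxt a j)"
      using weighted_mean_le_some[of s a "\<lambda>j. f (nxt a j) - g (nxt a j)"] by blast
    moreover have "q * ((\<Sum>j\<in>J. weight s a j * (w a j + f (nxt a j))) / q
        - (\<Sum>j\<in>J. weight s a j * (w a j + g (nxt a j))) / q)
        = (\<Sum>i\<in>J. weight s a i * (f (nxt a i) - g (nxt a i)))"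
    proof -
      have "q * (x / q - y / q) = x - y" for x y using q by (simp add: right_diff_distrib)
      thus ?thesis by (simp only:) (simp add: right_diff_distrib distrib_left sum.distrib sum_subtractf)
    qed
    ultimately show "\<exists>b\<in>W. q * ((\<Sum>j\<in>J. weight s a j * (w a j + f (nxt a j))) / q
        - (\<Sum>j\<in>J. weight s a j * (w a j + g (nxt a j))) / q) \<le> f b - g b"
      using nxt[OF a] by auto
  qed
  from someI_ex[OF this] assms q show ?thesis
    unfolding slope_def[symmetric] by (simp add: field_simps)
qed

text \<open>The height of the graph of \<open>F\<close> at \<open>t\<close> above its tangent at \<open>s\<close>.\<close>
definition excess :: "real \<Rightarrow> real \<Rightarrow> 'a \<Rightarrow> real" where
  "excess s t a = F t a - F s a - (t - s) * slope s a"

text \<open>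
  The tangent inequality at the point where \<open>F s\<close> is evaluated; the linear terms on its two sides
  cancel through the recursion for the slope, leaving only excesses.
\<close>
lemma excess_recursion:
  fixes s t :: real
  assumes a: "a \<in> W"
  defines "v \<equiv> \<lambda>j. (t - s) * w a j + (F t (nxt a j) - F s (nxt a j))"
  shows "(\<Sum>j\<in>J. weight s a j * excess s t (nxt a j)) \<le> q * excess s t a"
    and "(\<Sum>j\<in>J. weight s a j * excess s t (nxt a j)) = q * excess s t a \<Longrightarrow> j \<in> J
      \<Longrightarrow> v j = q * (F t a - F s a)"
proof -
  have v: "(\<lambda>j. (s * w a j + F s (nxt a j)) + v j) = (\<lambda>j. t * w a j + F t (nxt a j))"
    by (simp add: v_def algebra_simps)
  have diff: "q * (F t a - F s a) = log_sum_exp J (\<lambda>j. (s * w a j + F s (nxt a j)) + v j)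
      - log_sum_exp J (\<lambda>j. s * w a j + F s (nxt a j))"
    unfolding v using F[OF a, of t] F[OF a, of s] by (simp add: algebra_simps)
  have "(\<Sum>j\<in>J. weight s a j * excess s t (nxt a j))
      = (\<Sum>j\<in>J. weight s a j * v j - (t - s) * (weight s a j * (w a j + slope s (nxt a j))))"
    unfolding v_def excess_def by (intro sum.cong) (auto simp: algebra_simps)
  also have "\<dots> = (\<Sum>j\<in>J. weight s a j * v j) - (t - s) * (q * slope s a)"
    unfolding slope[OF a] by (simp add: sum_subtractf sum_distrib_left)
  finally have eq: "(\<Sum>j\<in>J. weight s a j * excess s t (nxt a j))
      = (\<Sum>j\<in>J. weight s a j * v j) - q * (F t a - F s a) + q * excess s t a"
    by (simp add: excess_def algebra_simps)
  note tangent = log_sum_exp_tangent[OF J, of "\<lambda>j. s * w a j + F s (nxt a j)" v,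
      folded weight_def diff]
  show "(\<Sum>j\<in>J. weight s a j * excess s t (nxt a j)) \<le> q * excess s t a"
    using tangent(1) eq by linarith
  assume "(\<Sum>j\<in>J. weight s a j * excess s t (nxt a j)) = q * excess s t a" "j \<in> J"
  thus "v j = q * (F t a - F s a)" using tangent(2) eq by simp
qed

lemma excess_nonneg:
  assumes "a \<in> W"
  shows "0 \<le> excess s t a"
proof -
  have "- excess s t a \<le> 0 / (q - 1)"
  proof (rule maximum_principle[OF finite_W q _ assms])
    fix a assume a: "a \<in> W"
    obtain j where "j \<in> J" "(\<Sum>i\<in>J. weight s a i * - excess s t (nxt a i)) \<le> - excess s t (nxt a j)"
      using weighted_mean_le_some[of s a "\<lambda>j. - excess s t (nxt a j)"] by blast
    thus "\<exists>b\<in>W. q * - excess s t a \<le> - excess s t b + 0"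
      using excess_recursion(1)[OF a, of s t] nxt[OF a] by (auto simp: sum_negf intro!: bexI[of _ "nxt a j"])
  qed
  thus ?thesis by simp
qed

text \<open>
  A nonnegative excess that vanishes at \<open>a\<close> has mean \<open>0\<close> over the successors of \<open>a\<close>, so it vanishes
  there too, and the tangent inequality at \<open>a\<close> is an equality.
\<close>
lemma excess_eq_0:
  assumes a: "a \<in> W" and 0: "excess s t a = 0" and j: "j \<in> J"
  shows "excess s t (nxt a j) = 0"
    and "(t - s) * w a j + (F t (nxt a j) - F s (nxt a j)) = q * (F t a - F s a)"
proof -
  have nn: "0 \<le> weight s a i * excess s t (nxt a i)" if "i \<in> J" for i
    using weight_pos[of s a i] excess_nonneg[OF nxt[OF a that]] by simp
  have sum0: "(\<Sum>j\<in>J. weight s a j * excess s t (nxt a j)) = 0"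
    using sum_nonneg[of J "\<lambda>j. weight s a j * excess s t (nxt a j)"] nn
      excess_recursion(1)[OF a, of s t] 0 by simp
  hence "weight s a j * excess s t (nxt a j) = 0"
    using nn j J(1) by (subst (asm) sum_nonneg_eq_0_iff) auto
  thus "excess s t (nxt a j) = 0" using weight_pos[of s a j] by simp
  show "(t - s) * w a j + (F t (nxt a j) - F s (nxt a j)) = q * (F t a - F s a)"
    using excess_recursion(2)[OF a _ j, of s t] sum0 0 by simp
qed

text \<open>
  Since the excess is nonnegative, only \<open>excess s (s + h) \<le> o(h)\<close> has to be shown. In one step of
  the recursion the excess at \<open>a\<close> is bounded by an excess at a successor plus the error of linearising
  log-sum-exp along a fixed line, which is \<open>o(h)\<close>; the maximum principle absorbs the former.
\<close>
lemma has_derivative_slope: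
  assumes a0: "a0 \<in> W"
  shows "((\<lambda>t. F t a0) has_real_derivative slope s a0) (at s)"
proof -
  (* the right-hand side of the recursion at a, with the slopes as candidate velocities *)
  define L where "L a h = log_sum_exp J (\<lambda>j. (s * w a j + F s (nxt a j)) + h * (w a j + slope s (nxt a j)))"
    for a h
  define R where "R h = (\<Sum>a\<in>W. \<bar>L a h - L a 0 - h * (q * slope s a)\<bar>)" for h
  have "((\<lambda>h. \<Sum>a\<in>W. \<bar>(L a h - L a 0) / h - q * slope s a\<bar>) \<longlongrightarrow> (\<Sum>a\<in>W. \<bar>q * slope s a - q * slope s a\<bar>)) (at 0)"
  proof (intro tendsto_intros)
    fix a assume a: "a \<in> W"
    have "(L a has_real_derivative q * slope s a) (at 0)"
      unfolding L_def slope[OF a] weight_def by (rule log_sum_exp_has_derivative[OF J])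
    thus "((\<lambda>h. (L a h - L a 0) / h) \<longlongrightarrow> q * slope s a) (at 0)"
      unfolding DERIV_def by simp
  qed
  hence lim: "((\<lambda>h. (\<Sum>a\<in>W. \<bar>(L a h - L a 0) / h - q * slope s a\<bar>) / (q - 1)) \<longlongrightarrow> 0) (at 0)"
    by (auto intro: tendsto_divide_zero)
  have R: "R h / \<bar>h\<bar> = (\<Sum>a\<in>W. \<bar>(L a h - L a 0) / h - q * slope s a\<bar>)" if "h \<noteq> 0" for h
    unfolding R_def sum_divide_distrib using that
    by (intro sum.cong) (auto simp flip: abs_divide simp: field_simps)
  have bound: "excess s (s + h) a0 \<le> R h / (q - 1)" for h
  proof (rule maximum_principle[OF finite_W q _ a0])
    fix a assume a: "a \<in> W"
    obtain j where j: "j \<in> J" and le: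
      "log_sum_exp J (\<lambda>j. (s + h) * w a j + F (s + h) (nxt a j)) - L a h
        \<le> ((s + h) * w a j + F (s + h) (nxt a j))
          - ((s * w a j + F s (nxt a j)) + h * (w a j + slope s (nxt a j)))"
      unfolding L_def using log_sum_exp_diff_le[OF J] by blast
    have L0: "L a 0 = q * F s a" unfolding L_def F[OF a] by simp
    have "L a h - L a 0 - h * (q * slope s a) \<le> R h"
      using member_le_sum[of a W "\<lambda>a. \<bar>L a h - L a 0 - h * (q * slope s a)\<bar>"] a finite_W
      unfolding R_def by (auto simp: abs_le_iff)
    with le L0 F[OF a, of "s + h"] have "q * excess s (s + h) a \<le> excess s (s + h) (nxt a j) + R h"
      unfolding excess_def by (simp add: algebra_simps)
    thus "\<exists>b\<in>W. q * excess s (s + h) a \<le> excess s (s + h) b + R h" using nxt[OF a j] by blast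
  qed
  have "norm ((F (s + h) a0 - F s a0) / h - slope s a0)
      \<le> (\<Sum>a\<in>W. \<bar>(L a h - L a 0) / h - q * slope s a\<bar>) / (q - 1)" if h: "h \<noteq> 0" for h
  proof -
    have "norm ((F (s + h) a0 - F s a0) / h - slope s a0) = \<bar>excess s (s + h) a0 / h\<bar>"
      using h by (simp add: excess_def field_simps)
    also have "\<dots> = excess s (s + h) a0 / \<bar>h\<bar>" using excess_nonneg[OF a0, of s "s + h"] by simp
    also have "\<dots> \<le> R h / (q - 1) / \<bar>h\<bar>" using bound by (rule divide_right_mono) simp
    also have "\<dots> = R h / \<bar>h\<bar> / (q - 1)" by simp
    finally show ?thesis unfolding R[OF h] .
  qed
  hence "\<forall>\<^sub>F h in at 0. norm ((F (s + h) a0 - F s a0) / h - slope s a0)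
      \<le> (\<Sum>a\<in>W. \<bar>(L a h - L a 0) / h - q * slope s a\<bar>) / (q - 1)"
    by (auto simp: eventually_at_filter)
  from Lim_null_comparison[OF this lim]
  have "((\<lambda>h. (F (s + h) a0 - F s a0) / h - slope s a0) \<longlongrightarrow> 0) (at 0)" .
  thus ?thesis unfolding DERIV_def by (simp add: LIM_zero_iff)
qed

text \<open>The maximum principle for \<open>slope s - c\<close>: the mean of \<open>w + c\<close> over successors is at most \<open>q c\<close>.\<close>
lemma slope_le_supersolution:
  assumes c: "\<And>a j. a \<in> W \<Longrightarrow> j \<in> J \<Longrightarrow> w a j + c (nxt a j) \<le> q * c a" and "a \<in> W"
  shows "slope s a \<le> c a"
proof -
  have "slope s a - c a \<le> 0 / (q - 1)"
  proof (rule maximum_principle[OF finite_W q _ \<open>a \<in> W\<close>])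
    fix a assume a: "a \<in> W"
    have "q * (slope s a - c a) = (\<Sum>j\<in>J. weight s a j * ((w a j + slope s (nxt a j)) - q * c a))"
      using slope[OF a, of s] by (simp add: right_diff_distrib sum_subtractf sum_weight flip: sum_distrib_right)
    also have "\<dots> \<le> (\<Sum>j\<in>J. weight s a j * (slope s (nxt a j) - c (nxt a j)))"
    proof (intro sum_mono mult_left_mono)
      fix j assume "j \<in> J"
      from c[OF a this] show "w a j + slope s (nxt a j) - q * c a \<le> slope s (nxt a j) - c (nxt a j)"
        by simp
    qed (rule less_imp_le[OF weight_pos])
    finally show "\<exists>b\<in>W. q * (slope s a - c a) \<le> slope s b - c b + 0"
      using weighted_mean_le_some[of s a "\<lambda>j. slope s (nxt a j) - c (nxt a j)"] nxt[OF a] by force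
  qed
  thus ?thesis by simp
qed

lemma slope_ge_subsolution:
  assumes c: "\<And>a j. a \<in> W \<Longrightarrow> j \<in> J \<Longrightarrow> q * c a \<le> w a j + c (nxt a j)" and "a \<in> W"
  shows "c a \<le> slope s a"
proof -
  have "c a - slope s a \<le> 0 / (q - 1)"
  proof (rule maximum_principle[OF finite_W q _ \<open>a \<in> W\<close>])
    fix a assume a: "a \<in> W"
    have "q * (c a - slope s a) = (\<Sum>j\<in>J. weight s a j * (q * c a - (w a j + slope s (nxt a j))))"
      using slope[OF a, of s] by (simp add: right_diff_distrib sum_subtractf sum_weight flip: sum_distrib_right)
    also have "\<dots> \<le> (\<Sum>j\<in>J. weight s a j * (c (nxt a j) - slope s (nxt a j)))"
    proof (intro sum_mono mult_left_mono)
      fix j assume "j \<in> J"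
      from c[OF a this] show "q * c a - (w a j + slope s (nxt a j)) \<le> c (nxt a j) - slope s (nxt a j)"
        by simp
    qed (rule less_imp_le[OF weight_pos])
    finally show "\<exists>b\<in>W. q * (c a - slope s a) \<le> c b - slope s b + 0"
      using weighted_mean_le_some[of s a "\<lambda>j. c (nxt a j) - slope s (nxt a j)"] nxt[OF a] by force
  qed
  thus ?thesis by simp
qed

end

section \<open>The functions \<open>\<psi>\<^sub>s\<close> as a log-sum-exp recursion\<close>

lemma finite_words: "finite (words m k)"
proof -
  have "words m k = {a. set a \<subseteq> {..<m} \<and> length a = k}" by (auto simp: words_def)
  thus ?thesis using finite_lists_length_eq[of "{..<m}" k] by simp
qed

lemma set_tl_subset: "set (tl a) \<subseteq> set a"
  by (cases a) auto

text \<open>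
  Taking logarithms turns the equation into a fixed-point equation for a map that satisfies the
  hypothesis of the contraction lemma; positivity makes the two formulations equivalent.
\<close>
lemma ex1_psi_top:
  fixes \<phi> :: "nat list \<Rightarrow> real"
  assumes "m > 0" "l \<ge> 2" "q \<ge> 2"
  shows "\<exists>!f. f \<in> extensional (words m (l - 1)) \<and>
     (\<forall>a \<in> words m (l - 1). f a > 0 \<and>
        f a ^ q = (\<Sum>j<m. exp (s * \<phi> (a @ [j])) * f (tl a @ [j])))"
    (is "\<exists>!f. f \<in> extensional ?W \<and> ?P f")
proof -
  have J: "finite {..<m}" "{..<m} \<noteq> {}" using assms by auto
  have q: "real q > 1" using assms by simp
  have nxt: "tl a @ [j] \<in> ?W" if "a \<in> ?W" "j \<in> {..<m}" for a j
    using that assms set_tl_subset[of a] by (auto simp: words_def)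
  define T where "T f a = log_sum_exp {..<m} (\<lambda>j. s * \<phi> (a @ [j]) + f (tl a @ [j])) / q"
    for f and a :: "nat list"
  have contr: "\<exists>b\<in>?W. real q * (T f a - T g a) \<le> f b - g b" if a: "a \<in> ?W" for f g a
  proof -
    have "real q * (T f a - T g a)
        = log_sum_exp {..<m} (\<lambda>j. s * \<phi> (a @ [j]) + f (tl a @ [j]))
          - log_sum_exp {..<m} (\<lambda>j. s * \<phi> (a @ [j]) + g (tl a @ [j]))"
      using q by (simp add: T_def right_diff_distrib)
    thus ?thesis
      using log_sum_exp_diff_le[OF J, of "\<lambda>j. s * \<phi> (a @ [j]) + f (tl a @ [j])"
          "\<lambda>j. s * \<phi> (a @ [j]) + g (tl a @ [j])"] nxt[OF a] by force
  qed
  have equiv: "f a ^ q = (\<Sum>j<m. exp (s * \<phi> (a @ [j])) * f (tl a @ [j]))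
      \<longleftrightarrow> ln (f a) = T (\<lambda>b. ln (f b)) a"
    if pos: "\<And>a. a \<in> ?W \<Longrightarrow> f a > 0" and a: "a \<in> ?W" for f a
  proof -
    have "(\<Sum>j<m. exp (s * \<phi> (a @ [j])) * f (tl a @ [j]))
        = (\<Sum>j<m. exp (s * \<phi> (a @ [j]) + ln (f (tl a @ [j]))))"
      using pos[OF nxt[OF a]] by (intro sum.cong) (auto simp: exp_add)
    moreover have "f a ^ q = exp (q * ln (f a))"
      using pos[OF a] by (simp add: exp_of_nat_mult)
    moreover have "exp (q * y) = Z \<longleftrightarrow> y = ln Z / q" if "Z > 0" for y Z :: real
    proof -
      have "exp (q * y) = Z \<longleftrightarrow> q * y = ln Z" using that by (metis exp_ln ln_exp)
      thus ?thesis using q by (auto simp: field_simps)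
    qed
    ultimately show ?thesis using sum_exp_pos[OF J] unfolding T_def log_sum_exp_def by simp
  qed
  obtain f0 where f0: "\<And>a. a \<in> ?W \<Longrightarrow> f0 a = T f0 a"
    using contraction_fixed_point[OF finite_words q, of m "l - 1" T] contr by blast
  show ?thesis
  proof (rule ex_ex1I)
    define f where "f = restrict (\<lambda>a. exp (f0 a)) ?W"
    have "T (\<lambda>b. ln (f b)) a = T f0 a" if "a \<in> ?W" for a
      using nxt[OF that] unfolding T_def log_sum_exp_def f_def by simp
    hence "?P f" using equiv[of f] f0 by (auto simp: f_def)
    thus "\<exists>f. f \<in> extensional ?W \<and> ?P f" by (intro exI[of _ f]) (auto simp: f_def)
  next
    fix f g assume f: "f \<in> extensional ?W \<and> ?P f" and g: "g \<in> extensional ?W \<and> ?P g"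
    have le: "ln (f a) - ln (g a) \<le> 0 / (real q - 1)" if "a \<in> ?W" "?P f" "?P g" for f g a
    proof (rule maximum_principle[OF finite_words q _ that(1)])
      fix a assume "a \<in> ?W"
      thus "\<exists>b\<in>?W. real q * (ln (f a) - ln (g a)) \<le> ln (f b) - ln (g b) + 0"
        using contr[of a "\<lambda>b. ln (f b)" "\<lambda>b. ln (g b)"] equiv[of f a] equiv[of g a] that(2,3) by simp
    qed
    show "f = g"
    proof (rule extensionalityI[of _ ?W])
      fix a assume a: "a \<in> ?W"
      have "ln (f a) = ln (g a)" using le[OF a, of f g] le[OF a, of g f] f g by simp
      thus "f a = g a" using f g a by simp
    qed (use f g in auto)
  qed
qed

text \<open>
  The empty word is included: the extension of \<open>\<psi>\<^sub>s\<close> by one further step is what turns the sum in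
  the pressure into the \<open>q\<close>-th power of a value of \<open>\<psi>\<^sub>s\<close>.
\<close>
definition short_words :: "nat \<Rightarrow> nat \<Rightarrow> nat list set" where
  "short_words m l = {a. length a \<le> l - 1 \<and> set a \<subseteq> {..<m}}"

definition shift_append :: "nat \<Rightarrow> nat list \<Rightarrow> nat \<Rightarrow> nat list" where
  "shift_append l a j = (if length a < l - 1 then a @ [j] else tl a @ [j])"

definition potential :: "nat \<Rightarrow> (nat list \<Rightarrow> real) \<Rightarrow> nat list \<Rightarrow> nat \<Rightarrow> real" where
  "potential l \<phi> a j = (if length a < l - 1 then 0 else \<phi> (a @ [j]))"

lemma psi_pos:
  assumes "m > 0" "l \<ge> 2" "q \<ge> 2" "a \<in> short_words m l"
  shows "psi m l q \<phi> s a > 0"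
  using assms(4)
proof (induction "l - 1 - length a" arbitrary: a)
  case 0
  hence a: "a \<in> words m (l - 1)" by (auto simp: short_words_def words_def)
  hence "length a = l - 1" by (simp add: words_def)
  thus ?case using theI'[OF ex1_psi_top[OF assms(1-3), of s \<phi>]] a
    by (subst psi.simps) (simp add: psi_top_def)
next
  case (Suc n)
  have "psi m l q \<phi> s (a @ [j]) > 0" if "j < m" for j
    using Suc.hyps Suc.prems that by (intro Suc.hyps(1)) (auto simp: short_words_def)
  hence "(\<Sum>j<m. psi m l q \<phi> s (a @ [j])) > 0" using assms(1) by (intro sum_pos) auto
  moreover have "\<not> l - 1 \<le> length a" using Suc.hyps(2) by linarith
  ultimately show ?case unfolding psi.simps[of m l q \<phi> s a] by simp
qed

lemma shift_append_in_short_words: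
  assumes "l \<ge> 2" "a \<in> short_words m l" "j < m"
  shows "shift_append l a j \<in> short_words m l"
  using assms set_tl_subset[of a] by (auto simp: short_words_def shift_append_def)

lemma ln_psi_recursion:
  assumes "m > 0" "l \<ge> 2" "q \<ge> 2" "a \<in> short_words m l"
  shows "real q * ln (psi m l q \<phi> s a)
    = log_sum_exp {..<m} (\<lambda>j. s * potential l \<phi> a j + ln (psi m l q \<phi> s (shift_append l a j)))"
proof -
  have pos: "psi m l q \<phi> s (shift_append l a j) > 0" if "j < m" for j
    using psi_pos[OF assms(1-3) shift_append_in_short_words[OF assms(2,4) that]] .
  have "(\<Sum>j<m. exp (s * potential l \<phi> a j + ln (psi m l q \<phi> s (shift_append l a j))))
      = (\<Sum>j<m. exp (s * potential l \<phi> a j) * psi m l q \<phi> s (shift_append l a j))"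
    using pos by (intro sum.cong) (auto simp: exp_add)
  also have "\<dots> = psi m l q \<phi> s a ^ q"
  proof (cases "length a < l - 1")
    case True
    have "(\<Sum>j<m. psi m l q \<phi> s (a @ [j])) > 0"
      using assms(1) pos True by (intro sum_pos) (auto simp: shift_append_def)
    thus ?thesis using True assms(3)
      by (subst (2) psi.simps) (simp add: potential_def shift_append_def powr_power)
  next
    case False
    hence a: "a \<in> words m (l - 1)" using assms(4) by (auto simp: short_words_def words_def)
    hence len: "length a = l - 1" by (simp add: words_def)
    have "psi m l q \<phi> s b = psi_top m l q \<phi> s b" if "length b = l - 1" for b
      using that by (subst psi.simps) simp
    thus ?thesis
      using theI'[OF ex1_psi_top[OF assms(1-3), of s \<phi>]] a len assms(2)
      by (simp add: potential_def shift_append_def psi_top_def)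
  qed
  finally show ?thesis unfolding log_sum_exp_def using psi_pos[OF assms]
    by (simp add: ln_realpow)
qed

section \<open>The pressure function\<close>

lemma strict_mono_bounded_limits:
  fixes f :: "real \<Rightarrow> real"
  assumes mono: "strict_mono f" and bounds: "\<And>x. L \<le> f x" "\<And>x. f x \<le> U"
  shows "\<exists>A B. (f \<longlongrightarrow> A) at_bot \<and> (f \<longlongrightarrow> B) at_top \<and> L \<le> A \<and> A < B \<and> B \<le> U"
proof -
  let ?A = "INF x. f x" and ?B = "SUP x. f x"
  have bdd: "bdd_below (range f)" "bdd_above (range f)"
    using bounds by (auto intro: bdd_belowI2[of _ L] bdd_aboveI2[of _ _ U])
  note le = strict_mono_less_eq[OF mono]
  have "(f \<longlongrightarrow> ?A) at_bot"
  proof (rule decreasing_tendsto)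
    fix y assume "?A < y"
    then obtain x0 where "f x0 < y" using bdd by (auto simp: cINF_less_iff)
    thus "\<forall>\<^sub>F x in at_bot. f x < y"
      using le by (intro eventually_at_bot_linorderI[of x0]) (meson le_less_trans)
  qed (intro always_eventually allI cINF_lower bdd UNIV_I)
  moreover have "(f \<longlongrightarrow> ?B) at_top"
  proof (rule increasing_tendsto)
    fix y assume "y < ?B"
    then obtain x0 where "y < f x0" using bdd by (auto simp: less_cSUP_iff)
    thus "\<forall>\<^sub>F x in at_top. y < f x"
      using le by (intro eventually_at_top_linorderI[of x0]) (meson less_le_trans)
  qed (intro always_eventually allI cSUP_upper bdd UNIV_I)
  moreover have "L \<le> ?A" "?B \<le> U" using bounds by (auto intro: cINF_greatest cSUP_least)
  moreover have "?A \<le> f 0" "f 0 < f 1" "f 1 \<le> ?B"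
    using bdd mono by (auto intro: cINF_lower cSUP_upper simp: strict_mono_def)
  ultimately show ?thesis by (metis le_less_trans less_le_trans)
qed

theorem theorem5p6:
  fixes m l q :: nat and \<phi> :: "nat list \<Rightarrow> real"
  assumes "m \<ge> 2" and "l \<ge> 2" and "q \<ge> 2"
    and "alpha_min m l \<phi> < alpha_max m l \<phi>"
  shows "(\<forall>s. pressure m l q \<phi> field_differentiable at s) \<and>
    strict_mono (deriv (pressure m l q \<phi>)) \<and>
    (\<exists>A B. (deriv (pressure m l q \<phi>) \<longlongrightarrow> A) at_bot \<and>
           (deriv (pressure m l q \<phi>) \<longlongrightarrow> B) at_top \<and>
           alpha_min m l \<phi> \<le> A \<and> A < B \<and> B \<le> alpha_max m l \<phi>)"
proof -
  let ?W = "short_words m l"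
  define F where "F s a = ln (psi m l q \<phi> s a)" for s a
  have m: "m > 0" using assms by simp
  have q: "real q > 1" using assms by simp
  have "finite ?W"
    using finite_lists_length_le[of "{..<m}" "l - 1"] by (simp add: short_words_def conj_commute)
  interpret log_sum_exp_system ?W "{..<m}" "real q" "shift_append l" "potential l \<phi>" F
    using \<open>finite ?W\<close> m q shift_append_in_short_words[OF assms(2)]
      ln_psi_recursion[OF m assms(2,3)]
    by unfold_locales (auto simp: F_def)

  define K where "K = (real q - 1) * real q ^ (l - 1)"
  have K: "K > 0" using q by (simp add: K_def)
  have nil: "[] \<in> ?W" by (simp add: short_words_def)
  have top: "a @ [j] \<in> words m l" if "a \<in> ?W" "\<not> length a < l - 1" "j < m" for a j
    using that assms(2) by (auto simp: short_words_def words_def)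
  have shift_length: "length (shift_append l a j) = (if length a < l - 1 then Suc (length a) else l - 1)"
    if "a \<in> ?W" for a j
    using that assms(2) by (auto simp: short_words_def shift_append_def)
  have fin\<phi>: "finite (\<phi> ` words m l)" using finite_words by simp

  have pressure: "pressure m l q \<phi> s = K * F s []" for s
  proof -
    have "0 < l - 1" and "l - 1 = Suc (l - 2)" using assms(2) by linarith+
    moreover have "real q * F s [] = ln (\<Sum>j<m. psi m l q \<phi> s [j])"
    proof -
      have "psi m l q \<phi> s [j] > 0" if "j < m" for j
        using that assms by (intro psi_pos) (auto simp: short_words_def)
      hence "0 < (\<Sum>j<m. psi m l q \<phi> s [j])" using m by (intro sum_pos) auto
      thus ?thesis unfolding F_def using \<open>0 < l - 1\<close> q by (subst psi.simps) (simp add: ln_powr)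
    qed
    ultimately show ?thesis by (simp add: pressure_def K_def flip: mult.assoc)
  qed
  have deriv: "(pressure m l q \<phi> has_real_derivative K * slope s []) (at s)" for s
    unfolding pressure[abs_def] by (intro DERIV_cmult has_derivative_slope nil)
  have deriv_eq: "deriv (pressure m l q \<phi>) s = K * slope s []" for s
    using deriv by (rule DERIV_imp_deriv)

  (* If the tangent at s touched the graph at t, equality would spread from the empty word to all
     words: D is multiplied by q at each added letter, and at full length this determines \<phi>. *)
  have excess_pos: "0 < excess s t []" if "s \<noteq> t" for s t
  proof (rule ccontr)
    assume "\<not> ?thesis"
    hence 0: "excess s t [] = 0" using excess_nonneg[OF nil, of s t] by simp
    define D where "D a = F t a - F s a" for a
    have rigid: "excess s t a = 0 \<and> D a = real q ^ length a * D []" if "a \<in> ?W" for a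
      using that
    proof (induction a rule: rev_induct)
      case (snoc j a)
      hence a: "a \<in> ?W" and j: "j < m" and len: "length a < l - 1"
        by (auto simp: short_words_def)
      have shift: "shift_append l a j = a @ [j]" and "potential l \<phi> a j = 0"
        using len by (simp_all add: shift_append_def potential_def)
      thus ?case using excess_eq_0[OF a, of s t j] snoc.IH[OF a] j by (simp add: D_def)
    qed (simp add: 0)
    have const: "\<phi> b = K * D [] / (t - s)" if b: "b \<in> words m l" for b
    proof -
      obtain a j where aj: "b = a @ [j]" using b assms(2) by (cases b rule: rev_cases) (auto simp: words_def)
      hence a: "a \<in> ?W" and len: "length a = l - 1" and j: "j < m"
        using b by (auto simp: words_def short_words_def)
      have "(t - s) * \<phi> b + D (shift_append l a j) = real q * D a"
        using excess_eq_0(2)[OF a, of s t j] rigid[OF a] j len aj by (simp add: potential_def D_def)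
      moreover have "D (shift_append l a j) = real q ^ (l - 1) * D []"
        using rigid[OF nxt[OF a, of j]] j len shift_length[OF a] by simp
      moreover have "D a = real q ^ (l - 1) * D []" using rigid[OF a] len by simp
      ultimately show ?thesis using \<open>s \<noteq> t\<close> by (simp add: K_def field_simps)
    qed
    have "replicate l 0 \<in> words m l" using m by (auto simp: words_def)
    hence "\<phi> ` words m l = {K * D [] / (t - s)}" using const by force
    thus False using assms(4) by (simp add: alpha_min_def alpha_max_def)
  qed

  have mono: "strict_mono (deriv (pressure m l q \<phi>))"
  proof (rule strict_monoI)
    fix s t :: real assume "s < t"
    hence "0 < excess s t [] + excess t s []" using excess_pos[of s t] excess_pos[of t s] by simp
    also have "\<dots> = (t - s) * (slope t [] - slope s [])" by (simp add: excess_def algebra_simps)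
    finally have "slope s [] < slope t []" using \<open>s < t\<close> by (simp add: zero_less_mult_iff)
    thus "deriv (pressure m l q \<phi>) s < deriv (pressure m l q \<phi>) t" using K by (simp add: deriv_eq)
  qed

  (* the slopes that a constant \<phi> = \<alpha> would produce *)
  define c where "c \<alpha> a = \<alpha> * real q ^ length a / K" for \<alpha> :: real and a :: "nat list"
  have c: "real q * c \<alpha> a = (if length a < l - 1 then 0 else \<alpha>) + c \<alpha> (shift_append l a j)"
    if "a \<in> ?W" for \<alpha> a j
  proof (cases "length a < l - 1")
    case False
    hence "length a = l - 1" using that by (simp add: short_words_def)
    moreover from this have "c \<alpha> (shift_append l a j) = c \<alpha> a"
      using shift_length[OF that, of j] by (simp add: c_def)
    moreover have "\<alpha> = c \<alpha> a * (real q - 1)"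
      using \<open>length a = l - 1\<close> q by (simp add: c_def K_def)
    ultimately show ?thesis by (simp add: algebra_simps)
  qed (use shift_length[OF that, of j] in \<open>simp add: c_def\<close>)
  have "slope s [] \<le> c (alpha_max m l \<phi>) []" for s
  proof (rule slope_le_supersolution[OF _ nil])
    fix a j assume a: "a \<in> ?W" and j: "j \<in> {..<m}"
    show "potential l \<phi> a j + c (alpha_max m l \<phi>) (shift_append l a j) \<le> real q * c (alpha_max m l \<phi>) a"
      unfolding c[OF a, of _ j] using top[OF a, of j] j fin\<phi> by (simp add: potential_def alpha_max_def)
  qed
  hence upper: "deriv (pressure m l q \<phi>) s \<le> alpha_max m l \<phi>" for s
    using K by (simp add: deriv_eq c_def field_simps)
  have "c (alpha_min m l \<phi>) [] \<le> slope s []" for s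
  proof (rule slope_ge_subsolution[OF _ nil])
    fix a j assume a: "a \<in> ?W" and j: "j \<in> {..<m}"
    show "real q * c (alpha_min m l \<phi>) a \<le> potential l \<phi> a j + c (alpha_min m l \<phi>) (shift_append l a j)"
      unfolding c[OF a, of _ j] using top[OF a, of j] j fin\<phi> by (simp add: potential_def alpha_min_def)
  qed
  hence lower: "alpha_min m l \<phi> \<le> deriv (pressure m l q \<phi>) s" for s
    using K by (simp add: deriv_eq c_def field_simps)

  have "pressure m l q \<phi> field_differentiable at s" for s
    using deriv unfolding field_differentiable_def by blast
  with mono strict_mono_bounded_limits[OF mono lower upper] show ?thesis by blast
qed

end
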